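(* Consider the combined side-payment and content-restriction mechanism for two user types. (i) Full participation: if $SW(\check{x}_H,\check{a})\ge SW_{1/2}(\tilde{x}_H)$, it is optimal to keep both types' individual rationality and to incentivize $\hat{x}_H=\check{x}_H$ by choosing $a=\check{a}$ and the payment function $$g(x_H)=\begin{cases}\infty,&x_H\in[0,\hat{x}_H),\\(c_H-(1-a)\theta_2Q(\hat{x}_H,1))\hat{x}_H,&x_H=\hat{x}_H,\\-\infty,&x_H\in(\hat{x}_H,1];\end{cases}$$ the resulting social welfare is $SW(\check{x}_H,\check{a})$. (ii) Half participation: if $SW(\check{x}_H,\check{a})<SW_{1/2}(\tilde{x}_H)$, it is optimal to satisfy only type-2 users' individual rationality and to incentivize $\hat{x}_H=\tilde{x}_H$ by choosing $a=1$ and $$g(x_H)=\frac{\hat{x}_Hc_H(b-x_H)}{b(b-\hat{x}_H)},\qquad b=\tfrac12;$$ the resulting social welfare is $SW_{1/2}(\tilde{x}_H)$.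
   Context: A unit mass of non-atomic users chooses between path $H$ (travel cost $c_H>0$) and path $L$ (cost $0$). Half of the users have valuation $\theta_1>0$ and half $\theta_2>\theta_1$. $Q_1:[0,1]\to[0,\infty)$ is continuous, concave, nondecreasing, $Q_1(0)=0$; $Q(x,b)=Q_1(x)+Q_1(b-x)$ is the content when a mass $b$ participates and $x$ of it takes $H$; $Q(\cdot,1)$ is strictly increasing on $[0,1/2]$. Combined mechanism: the planner chooses $a\in[0,1]$ and a payment function $g$ (infinite values stand for sufficiently large finite ones); each $L$-user pays $g(x_H)$ and gets the fraction $a$ of the content, each $H$-user receives $\frac{b-x_H}{x_H}g(x_H)$. Payoffs: $u_i(L,x_H)=a\theta_iQ(x_H,b)-g(x_H)$, $u_i(H,x_H)=\theta_iQ(x_H,b)-c_H+\frac{b-x_H}{x_H}g(x_H)$. Individual rationality (IR): participating users have nonnegative payoff; users who would have negative payoff do not participate. An equilibrium is a state in which no participating user gains by switching path. Social welfare is the sum of participating users' payoffs. Optimality is among stable equilibria with positive flow on both paths in the following cases: full participation ($b=1$, IR of both types) with type-2 users indifferent between paths (Case.IR21, type-1 users all on $L$), with type-1 users indifferent (Case.IR12, type-2 users all on $H$), or with all type-1 on $L$ and all type-2 on $H$; and half participation ($b=1/2$, only type-2 users participate; Case.IR2). $(\check{x}_H,\check{a})$ denotes an optimal solution (assumed to exist) of the Case.IR21 problem $$\max_{x\in(0,1/2],\,a\in[0,1]}\ \Big(x\theta_2+\big((\tfrac12-x)\theta_2+\tfrac12\theta_1\big)a\Big)Q(x,1)-xc_H\quad\text{s.t.}\quad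 \theta_1aQ(x,1)-(c_H-(1-a)\theta_2Q(x,1))x\ge0,$$ and $SW(\check{x}_H,\check{a})$ its optimal value. $\tilde{x}_H\in\arg\max_{x\in[0,1/2]}SW_{1/2}(x)$ with $SW_{1/2}(x)=\tfrac12\theta_2Q(x,\tfrac12)-xc_H$. *)

theory Defs
  imports "HOL-Analysis.Analysis"
begin

datatype user_type = Type1 | Type2

datatype path = PathH | PathL

text \<open>A profile assigns to each type and path the mass of \<^emph>\<open>participating\<close> users of that type
  on that path; the rest of the mass \<open>1/2\<close> of a type does not participate.\<close>

type_synonym profile = "user_type \<Rightarrow> path \<Rightarrow> real"

definition valid_profile :: "profile \<Rightarrow> bool" where
  "valid_profile s \<longleftrightarrow> (\<forall>i p. 0 \<le> s i p) \<and> (\<forall>i. s i PathH + s i PathL \<le> 1/2)"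

definition flow_H :: "profile \<Rightarrow> real" where
  "flow_H s = s Type1 PathH + s Type2 PathH"

definition participation :: "profile \<Rightarrow> real" where
  "participation s = (\<Sum>i\<in>{Type1, Type2}. s i PathH + s i PathL)"

definition Qtot :: "(real \<Rightarrow> real) \<Rightarrow> real \<Rightarrow> real \<Rightarrow> real" where
  "Qtot Q1 x b = Q1 x + Q1 (b - x)"

text \<open>Payoffs when a mass \<open>x\<close> out of \<open>b\<close> participants is on \<open>H\<close>. The \<open>H\<close>-payoff is only meaningful
  for \<open>x > 0\<close>; every use below is guarded accordingly.\<close>

fun payoff :: "(user_type \<Rightarrow> real) \<Rightarrow> real \<Rightarrow> (real \<Rightarrow> real) \<Rightarrow> real \<Rightarrow> (real \<Rightarrow> real)
    \<Rightarrow> real \<Rightarrow> user_type \<Rightarrow> path \<Rightarrow> real \<Rightarrow> real" where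
  "payoff \<theta> c Q1 a g b i PathL x = a * \<theta> i * Qtot Q1 x b - g x"
| "payoff \<theta> c Q1 a g b i PathH x = \<theta> i * Qtot Q1 x b - c + (b - x) / x * g x"

definition profile_payoff :: "(user_type \<Rightarrow> real) \<Rightarrow> real \<Rightarrow> (real \<Rightarrow> real) \<Rightarrow> real \<Rightarrow> (real \<Rightarrow> real)
    \<Rightarrow> profile \<Rightarrow> user_type \<Rightarrow> path \<Rightarrow> real" where
  "profile_payoff \<theta> c Q1 a g s i p = payoff \<theta> c Q1 a g (participation s) i p (flow_H s)"

definition social_welfare :: "(user_type \<Rightarrow> real) \<Rightarrow> real \<Rightarrow> (real \<Rightarrow> real) \<Rightarrow> real \<Rightarrow> (real \<Rightarrow> real)
    \<Rightarrow> profile \<Rightarrow> real" where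
  "social_welfare \<theta> c Q1 a g s =
     (\<Sum>i\<in>{Type1, Type2}. \<Sum>p\<in>{PathH, PathL}. s i p * profile_payoff \<theta> c Q1 a g s i p)"

text \<open>Users are non-atomic, so a single user who switches path (or joins) leaves the flow and the
  participation unchanged.\<close>

definition equilibrium :: "(user_type \<Rightarrow> real) \<Rightarrow> real \<Rightarrow> (real \<Rightarrow> real) \<Rightarrow> real \<Rightarrow> (real \<Rightarrow> real)
    \<Rightarrow> profile \<Rightarrow> bool" where
  "equilibrium \<theta> c Q1 a g s \<longleftrightarrow>
     (\<forall>i p q. 0 < s i p \<longrightarrow> profile_payoff \<theta> c Q1 a g s i q \<le> profile_payoff \<theta> c Q1 a g s i p)"

text \<open>Stability against small deviations at fixed participation: whenever a small mass of users
  leaves one path for the other, the types that may have deviated strictly prefer to go back.\<close>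

definition stable_equilibrium :: "(user_type \<Rightarrow> real) \<Rightarrow> real \<Rightarrow> (real \<Rightarrow> real) \<Rightarrow> real \<Rightarrow> (real \<Rightarrow> real)
    \<Rightarrow> profile \<Rightarrow> bool" where
  "stable_equilibrium \<theta> c Q1 a g s \<longleftrightarrow>
     equilibrium \<theta> c Q1 a g s \<and>
     (let b = participation s in
      \<exists>\<epsilon>>0. \<forall>x. 0 < x \<and> x < b \<and> \<bar>x - flow_H s\<bar> < \<epsilon> \<longrightarrow>
        (x < flow_H s \<longrightarrow> (\<forall>i. 0 < s i PathH \<longrightarrow>
           payoff \<theta> c Q1 a g b i PathL x < payoff \<theta> c Q1 a g b i PathH x)) \<and>
        (flow_H s < x \<longrightarrow> (\<forall>i. 0 < s i PathL \<longrightarrow>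
           payoff \<theta> c Q1 a g b i PathH x < payoff \<theta> c Q1 a g b i PathL x)))"

text \<open>Participants have nonnegative payoff, and a type stays (even partly) out only if its users
  would have negative payoff on either path.\<close>

definition individually_rational :: "(user_type \<Rightarrow> real) \<Rightarrow> real \<Rightarrow> (real \<Rightarrow> real) \<Rightarrow> real
    \<Rightarrow> (real \<Rightarrow> real) \<Rightarrow> profile \<Rightarrow> bool" where
  "individually_rational \<theta> c Q1 a g s \<longleftrightarrow>
     (\<forall>i p. 0 < s i p \<longrightarrow> 0 \<le> profile_payoff \<theta> c Q1 a g s i p) \<and>
     (\<forall>i. s i PathH + s i PathL < 1/2 \<longrightarrow> (\<forall>p. profile_payoff \<theta> c Q1 a g s i p < 0))"

definition indifferent :: "(user_type \<Rightarrow> real) \<Rightarrow> real \<Rightarrow> (real \<Rightarrow> real) \<Rightarrow> real \<Rightarrow> (real \<Rightarrow> real)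
    \<Rightarrow> profile \<Rightarrow> user_type \<Rightarrow> bool" where
  "indifferent \<theta> c Q1 a g s i \<longleftrightarrow>
     profile_payoff \<theta> c Q1 a g s i PathH = profile_payoff \<theta> c Q1 a g s i PathL"

definition case_IR21 :: "(user_type \<Rightarrow> real) \<Rightarrow> real \<Rightarrow> (real \<Rightarrow> real) \<Rightarrow> real \<Rightarrow> (real \<Rightarrow> real)
    \<Rightarrow> profile \<Rightarrow> bool" where
  "case_IR21 \<theta> c Q1 a g s \<longleftrightarrow>
     s Type1 PathH = 0 \<and> s Type1 PathL = 1/2 \<and> s Type2 PathH + s Type2 PathL = 1/2 \<and>
     indifferent \<theta> c Q1 a g s Type2"

definition case_IR12 :: "(user_type \<Rightarrow> real) \<Rightarrow> real \<Rightarrow> (real \<Rightarrow> real) \<Rightarrow> real \<Rightarrow> (real \<Rightarrow> real)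
    \<Rightarrow> profile \<Rightarrow> bool" where
  "case_IR12 \<theta> c Q1 a g s \<longleftrightarrow>
     s Type2 PathH = 1/2 \<and> s Type2 PathL = 0 \<and> s Type1 PathH + s Type1 PathL = 1/2 \<and>
     indifferent \<theta> c Q1 a g s Type1"

definition case_separated :: "profile \<Rightarrow> bool" where
  "case_separated s \<longleftrightarrow>
     s Type1 PathH = 0 \<and> s Type1 PathL = 1/2 \<and> s Type2 PathH = 1/2 \<and> s Type2 PathL = 0"

definition case_IR2 :: "profile \<Rightarrow> bool" where
  "case_IR2 s \<longleftrightarrow>
     s Type1 PathH = 0 \<and> s Type1 PathL = 0 \<and> s Type2 PathH + s Type2 PathL = 1/2"

definition admissible :: "(user_type \<Rightarrow> real) \<Rightarrow> real \<Rightarrow> (real \<Rightarrow> real) \<Rightarrow> real \<Rightarrow> (real \<Rightarrow> real)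
    \<Rightarrow> profile \<Rightarrow> bool" where
  "admissible \<theta> c Q1 a g s \<longleftrightarrow>
     a \<in> {0..1} \<and> valid_profile s \<and>
     0 < flow_H s \<and> flow_H s < participation s \<and>
     stable_equilibrium \<theta> c Q1 a g s \<and> individually_rational \<theta> c Q1 a g s \<and>
     (case_IR21 \<theta> c Q1 a g s \<or> case_IR12 \<theta> c Q1 a g s \<or> case_separated s \<or> case_IR2 s)"

definition optimal :: "(user_type \<Rightarrow> real) \<Rightarrow> real \<Rightarrow> (real \<Rightarrow> real) \<Rightarrow> real \<Rightarrow> (real \<Rightarrow> real)
    \<Rightarrow> profile \<Rightarrow> bool" where
  "optimal \<theta> c Q1 a g s \<longleftrightarrow>
     is_arg_max (\<lambda>(a, g, s). social_welfare \<theta> c Q1 a g s)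
       (\<lambda>(a, g, s). admissible \<theta> c Q1 a g s) (a, g, s)"

definition SW_full :: "(user_type \<Rightarrow> real) \<Rightarrow> real \<Rightarrow> (real \<Rightarrow> real) \<Rightarrow> real \<Rightarrow> real \<Rightarrow> real" where
  "SW_full \<theta> c Q1 x a =
     (x * \<theta> Type2 + ((1/2 - x) * \<theta> Type2 + 1/2 * \<theta> Type1) * a) * Qtot Q1 x 1 - x * c"

definition IR21_feasible :: "(user_type \<Rightarrow> real) \<Rightarrow> real \<Rightarrow> (real \<Rightarrow> real) \<Rightarrow> real \<Rightarrow> real \<Rightarrow> bool" where
  "IR21_feasible \<theta> c Q1 x a \<longleftrightarrow>
     x \<in> {0<..1/2} \<and> a \<in> {0..1} \<and>
     \<theta> Type1 * a * Qtot Q1 x 1 - (c - (1 - a) * \<theta> Type2 * Qtot Q1 x 1) * x \<ge> 0"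

definition SW_half :: "(user_type \<Rightarrow> real) \<Rightarrow> real \<Rightarrow> (real \<Rightarrow> real) \<Rightarrow> real \<Rightarrow> real" where
  "SW_half \<theta> c Q1 x = 1/2 * \<theta> Type2 * Qtot Q1 x (1/2) - x * c"

text \<open>The bound \<open>M\<close> stands for the infinite payments.\<close>

definition full_payment :: "(user_type \<Rightarrow> real) \<Rightarrow> real \<Rightarrow> (real \<Rightarrow> real) \<Rightarrow> real \<Rightarrow> real \<Rightarrow> real
    \<Rightarrow> real \<Rightarrow> real" where
  "full_payment \<theta> c Q1 a xh M x =
     (if x < xh then M
      else if x = xh then (c - (1 - a) * \<theta> Type2 * Qtot Q1 xh 1) * xh
      else - M)"

definition half_payment :: "real \<Rightarrow> real \<Rightarrow> real \<Rightarrow> real \<Rightarrow> real" where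
  "half_payment c xh b x = xh * c * (b - x) / (b * (b - xh))"

end

theory Submission
  imports Defs
begin

text \<open>Payments are transfers between participants, so the welfare of a state depends only on \<open>a\<close> and on
  the flows. Every admissible full-participation state is dominated by a feasible point of the
  Case.IR21 problem: in Case.IR12 at \<open>H\<close>-flow \<open>x\<close> one takes the mirrored flow \<open>1 - x\<close> with \<open>a = 1\<close>,
  which has the same content and a lower travel cost, while the separated case is the boundary
  point \<open>x = 1/2\<close>. Half participation is dominated by \<open>SW_half\<close>. What remains is that the proposed
  payments make the two optima admissible. For half participation, \<open>SW_full < SW_half\<close> is
  what excludes the degenerate optimum \<open>0\<close> and keeps type 1 users out: otherwise admitting them with
  \<open>a = 1\<close> would do at least as well.\<close>

section \<open>Welfare without transfers, and the incentive to switch path\<close>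

lemma all_user_type_iff: "(\<forall>i. P i) \<longleftrightarrow> P Type1 \<and> P Type2"
  by (metis user_type.exhaust)

lemma all_path_iff: "(\<forall>p. P p) \<longleftrightarrow> P PathH \<and> P PathL"
  by (metis path.exhaust)

lemma participation_eq:
  "participation s = s Type1 PathH + s Type1 PathL + s Type2 PathH + s Type2 PathL"
  by (simp add: participation_def)

text \<open>What the L-users pay in total is what the H-users receive in total, so \<open>g\<close>
  cancels. The H-flow must be nonzero: at zero flow the refund is lost to division by zero while the
  L-users still pay.\<close>

lemma social_welfare_eq:
  assumes "flow_H s \<noteq> 0"
  shows "social_welfare \<theta> c Q1 a g s =
    (\<theta> Type1 * (s Type1 PathH + a * s Type1 PathL) +
     \<theta> Type2 * (s Type2 PathH + a * s Type2 PathL)) * Qtot Q1 (flow_H s) (participation s)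
    - flow_H s * c"
proof -
  define x b where "x = flow_H s" and "b = participation s"
  define q t where "q = Qtot Q1 x b" and "t = (b - x) / x * g x"
  have L: "s Type1 PathL + s Type2 PathL = b - x" and H: "s Type1 PathH + s Type2 PathH = x"
    by (simp_all add: x_def b_def participation_eq flow_H_def)
  have "x * t = (b - x) * g x"
    using assms by (simp add: t_def x_def)
  then have cancel: "(s Type1 PathH + s Type2 PathH) * (t - c)
      = (s Type1 PathL + s Type2 PathL) * g x - x * c"
    unfolding L H by (simp add: algebra_simps)
  have "social_welfare \<theta> c Q1 a g s =
      s Type1 PathH * (\<theta> Type1 * q - c + t) + s Type1 PathL * (a * \<theta> Type1 * q - g x) +
      (s Type2 PathH * (\<theta> Type2 * q - c + t) + s Type2 PathL * (a * \<theta> Type2 * q - g x))"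
    by (simp add: social_welfare_def profile_payoff_def x_def b_def q_def t_def)
  also have "\<dots> = (\<theta> Type1 * (s Type1 PathH + a * s Type1 PathL) +
      \<theta> Type2 * (s Type2 PathH + a * s Type2 PathL)) * q - x * c"
    using cancel by (simp add: algebra_simps)
  finally show ?thesis
    by (simp add: q_def x_def b_def)
qed

text \<open>Both proposed states have this shape: \<open>m = 1/2\<close> gives full participation,
  \<open>m = 0\<close> keeps type 1 out.\<close>

definition split_profile :: "real \<Rightarrow> real \<Rightarrow> profile" where
  "split_profile m x i p = (case i of
     Type1 \<Rightarrow> (case p of PathH \<Rightarrow> 0 | PathL \<Rightarrow> m)
   | Type2 \<Rightarrow> (case p of PathH \<Rightarrow> x | PathL \<Rightarrow> 1/2 - x))"

lemma split_profile_simps [simp]: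
  "split_profile m x Type1 PathH = 0"
  "split_profile m x Type1 PathL = m"
  "split_profile m x Type2 PathH = x"
  "split_profile m x Type2 PathL = 1/2 - x"
  "flow_H (split_profile m x) = x"
  "participation (split_profile m x) = m + 1/2"
  by (simp_all add: split_profile_def flow_H_def participation_eq)

text \<open>Moving from L to H saves the payment \<open>g x\<close> and earns the refund, which
  together make \<open>b * g x / x\<close>. Indifference and stability thus become comparisons of
  one expression with \<open>c\<close>.\<close>

lemma payoff_H_minus_L:
  assumes "x \<noteq> 0"
  shows "payoff \<theta> c Q1 a g b i PathH x - payoff \<theta> c Q1 a g b i PathL x
    = (1 - a) * \<theta> i * Qtot Q1 x b + b * g x / x - c"
proof -
  have "(b - x) / x * g x = b * g x / x - g x"
    using assms by (simp add: field_simps)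
  then have "payoff \<theta> c Q1 a g b i PathH x
      = \<theta> i * Qtot Q1 x b - c + (b * g x / x - g x)"
    by simp
  then show ?thesis by (simp add: left_diff_distrib mult.assoc)
qed

lemma payoff_L_less_H_iff:
  assumes "x \<noteq> 0"
  shows "payoff \<theta> c Q1 a g b i PathL x < payoff \<theta> c Q1 a g b i PathH x
    \<longleftrightarrow> c < (1 - a) * \<theta> i * Qtot Q1 x b + b * g x / x"
  using payoff_H_minus_L[OF assms, of \<theta> c Q1 a g b i] by linarith

lemma payoff_H_less_L_iff:
  assumes "x \<noteq> 0"
  shows "payoff \<theta> c Q1 a g b i PathH x < payoff \<theta> c Q1 a g b i PathL x
    \<longleftrightarrow> (1 - a) * \<theta> i * Qtot Q1 x b + b * g x / x < c"
  using payoff_H_minus_L[OF assms, of \<theta> c Q1 a g b i] by linarith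

section \<open>Standing assumptions and bounds on the content\<close>

locale content_market =
  fixes \<theta> :: "user_type \<Rightarrow> real" and c :: real and Q1 :: "real \<Rightarrow> real"
  assumes c_pos: "0 < c"
    and valuations: "0 < \<theta> Type1" "\<theta> Type1 < \<theta> Type2"
    and Q1_range: "Q1 \<in> {0..1} \<rightarrow> {0..}"
    and Q1_mono: "mono_on {0..1} Q1"
    and Q1_zero: "Q1 0 = 0"
    and Q_strict: "strict_mono_on {0..1/2} (\<lambda>x. Qtot Q1 x 1)"
begin

lemma Q1_nonneg: "0 \<le> x \<Longrightarrow> x \<le> 1 \<Longrightarrow> 0 \<le> Q1 x"
  using Q1_range by auto

lemma Q1_le: "0 \<le> x \<Longrightarrow> x \<le> y \<Longrightarrow> y \<le> 1 \<Longrightarrow> Q1 x \<le> Q1 y"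
  using Q1_mono by (auto simp: mono_on_def)

lemma Qtot_nonneg: "0 \<le> x \<Longrightarrow> x \<le> b \<Longrightarrow> b \<le> 1 \<Longrightarrow> 0 \<le> Qtot Q1 x b"
  by (simp add: Qtot_def Q1_nonneg)

lemma Qtot_le: "0 \<le> x \<Longrightarrow> x \<le> b \<Longrightarrow> b \<le> 1 \<Longrightarrow> Qtot Q1 x b \<le> 2 * Q1 1"
  using Q1_le[of x 1] Q1_le[of "b - x" 1] by (simp add: Qtot_def)

lemma Qtot_half_le: "0 \<le> x \<Longrightarrow> x \<le> 1/2 \<Longrightarrow> Qtot Q1 x (1/2) \<le> Qtot Q1 x 1"
  using Q1_le[of "1/2 - x" "1 - x"] by (simp add: Qtot_def)

text \<open>Since \<open>Q1 0 = 0\<close>, the value \<open>Q1 1\<close> is the total content at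
  zero H-flow, from which the content grows on the left half.\<close>

lemma Q1_one_le_Qtot: "0 \<le> x \<Longrightarrow> x \<le> 1/2 \<Longrightarrow> Q1 1 \<le> Qtot Q1 x 1"
  using strict_mono_onD[OF Q_strict, of 0 x] Q1_zero
  by (cases "x = 0") (auto simp: Qtot_def)

text \<open>Strict growth gives \<open>Q1 1 < 2 * Q1 (1/2)\<close>, and the right-hand side is at
  most \<open>2 * Q1 1\<close>.\<close>

lemma Q1_one_pos: "0 < Q1 1"
proof -
  have "Qtot Q1 0 1 < Qtot Q1 (1/2) 1"
    using strict_mono_onD[OF Q_strict, of 0 "1/2"] by simp
  then show ?thesis
    using Q1_le[of "1/2" 1] Q1_zero by (simp add: Qtot_def)
qed

section \<open>Upper bounds on the welfare of admissible states\<close>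

lemma SW_full_one: "SW_full \<theta> c Q1 x 1 = (\<theta> Type1 + \<theta> Type2) / 2 * Qtot Q1 x 1 - x * c"
  by (simp add: SW_full_def algebra_simps)

lemma IR21_feasible_one:
  "IR21_feasible \<theta> c Q1 x 1 \<longleftrightarrow> 0 < x \<and> x \<le> 1/2 \<and> x * c \<le> \<theta> Type1 * Qtot Q1 x 1"
  by (auto simp: IR21_feasible_def algebra_simps)

text \<open>Indifference of type 2 determines \<open>g\<close> at the equilibrium flow; inserting
  this value into the IR condition of type 1 on L yields exactly the constraint of the reduced
  problem.\<close>

lemma case_IR21_bound:
  assumes adm: "admissible \<theta> c Q1 a g s" and IR21: "case_IR21 \<theta> c Q1 a g s"
  shows "\<exists>x a'. IR21_feasible \<theta> c Q1 x a' \<and> social_welfare \<theta> c Q1 a g s \<le> SW_full \<theta> c Q1 x a'"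
proof (intro exI conjI)
  define x where "x = flow_H s"
  have s: "s Type1 PathH = 0" "s Type1 PathL = 1/2" "s Type2 PathH = x" "s Type2 PathL = 1/2 - x"
    using IR21 by (auto simp: case_IR21_def x_def flow_H_def)
  have b: "participation s = 1"
    by (simp add: participation_eq s)
  have "0 \<le> s Type2 PathL"
    using adm by (auto simp: admissible_def valid_profile_def)
  then have x: "0 < x" "x \<le> 1/2" and a: "a \<in> {0..1}"
    using adm s(4) by (auto simp: admissible_def x_def)
  have "payoff \<theta> c Q1 a g 1 Type2 PathH x = payoff \<theta> c Q1 a g 1 Type2 PathL x"
    using IR21 by (simp add: case_IR21_def indifferent_def profile_payoff_def b x_def)
  then have "g x / x = c - (1 - a) * \<theta> Type2 * Qtot Q1 x 1"
    using payoff_H_minus_L[of x \<theta> c Q1 a g 1 Type2] x by simp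
  then have g: "g x = (c - (1 - a) * \<theta> Type2 * Qtot Q1 x 1) * x"
    using x by (simp add: field_simps)
  have "0 \<le> profile_payoff \<theta> c Q1 a g s Type1 PathL"
    using adm s(2) by (simp add: admissible_def individually_rational_def)
  then have "g x \<le> a * \<theta> Type1 * Qtot Q1 x 1"
    by (simp add: profile_payoff_def b x_def)
  then show "IR21_feasible \<theta> c Q1 x a"
    using x a unfolding g by (simp add: IR21_feasible_def algebra_simps)
  show "social_welfare \<theta> c Q1 a g s \<le> SW_full \<theta> c Q1 x a"
    using social_welfare_eq[of s \<theta> c Q1 a g, folded x_def] x
    by (simp add: s b SW_full_def algebra_simps)
qed

lemma case_IR12_bound:
  assumes adm: "admissible \<theta> c Q1 a g s" and IR12: "case_IR12 \<theta> c Q1 a g s"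
  shows "\<exists>x a'. IR21_feasible \<theta> c Q1 x a' \<and> social_welfare \<theta> c Q1 a g s \<le> SW_full \<theta> c Q1 x a'"
proof (intro exI conjI)
  define x q where "x = flow_H s" and "q = Qtot Q1 x 1"
  have s: "s Type2 PathH = 1/2" "s Type2 PathL = 0" "s Type1 PathH = x - 1/2" "s Type1 PathL = 1 - x"
    using IR12 by (auto simp: case_IR12_def x_def flow_H_def)
  have b: "participation s = 1"
    by (simp add: participation_eq s)
  have "0 \<le> s Type1 PathH"
    using adm by (auto simp: admissible_def valid_profile_def)
  then have x: "1/2 \<le> x" "x < 1" and a: "0 \<le> a" "a \<le> 1"
    using adm s(3) by (auto simp: admissible_def x_def b)
  have q: "0 \<le> q"
    unfolding q_def using x by (intro Qtot_nonneg) auto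
  have mirror: "Qtot Q1 (1 - x) 1 = q"
    by (simp add: q_def Qtot_def)
  have "payoff \<theta> c Q1 a g 1 Type1 PathH x = payoff \<theta> c Q1 a g 1 Type1 PathL x"
    using IR12 by (simp add: case_IR12_def indifferent_def profile_payoff_def b x_def)
  then have "g x / x = c - (1 - a) * \<theta> Type1 * q"
    using payoff_H_minus_L[of x \<theta> c Q1 a g 1 Type1] x by (simp add: q_def)
  then have g: "g x = (c - (1 - a) * \<theta> Type1 * q) * x"
    using x by (simp add: field_simps)
  have "0 \<le> profile_payoff \<theta> c Q1 a g s Type1 PathL"
    using adm s(4) x by (simp add: admissible_def individually_rational_def)
  then have "g x \<le> a * \<theta> Type1 * q"
    by (simp add: profile_payoff_def b x_def q_def)
  \<comment> \<open>The factor \<open>a + x * (1 - a)\<close> is a convex combination of 1 and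
    \<open>x\<close>, hence at most 1, so the constraint relaxes to its form for
    \<open>a = 1\<close>.\<close>
  then have "x * c \<le> (a + x * (1 - a)) * (\<theta> Type1 * q)"
    unfolding g by (simp add: algebra_simps)
  also have "\<dots> \<le> 1 * (\<theta> Type1 * q)"
  proof (rule mult_right_mono)
    have "x * (1 - a) \<le> 1 * (1 - a)"
      using x a by (intro mult_right_mono) auto
    then show "a + x * (1 - a) \<le> 1" by (simp add: algebra_simps)
  qed (use valuations q in simp)
  finally have "x * c \<le> \<theta> Type1 * q" by simp
  moreover have cost: "(1 - x) * c \<le> x * c"
    using x c_pos by (intro mult_right_mono) auto
  ultimately show "IR21_feasible \<theta> c Q1 (1 - x) 1"
    using x by (simp add: IR21_feasible_one mirror)
  have "social_welfare \<theta> c Q1 a g s =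
      (\<theta> Type1 * (x - 1/2 + a * (1 - x)) + \<theta> Type2 * (1/2)) * q - x * c"
    using social_welfare_eq[of s \<theta> c Q1 a g, folded x_def] x by (simp add: s b q_def)
  also have "\<dots> \<le> (\<theta> Type1 * (1/2) + \<theta> Type2 * (1/2)) * q - (1 - x) * c"
  proof (rule diff_mono[OF mult_right_mono[OF add_right_mono[OF mult_left_mono]] cost])
    have "a * (1 - x) \<le> 1 * (1 - x)"
      using x a by (intro mult_right_mono) auto
    then show "x - 1/2 + a * (1 - x) \<le> 1/2" by (simp add: algebra_simps)
  qed (use valuations q in auto)
  finally show "social_welfare \<theta> c Q1 a g s \<le> SW_full \<theta> c Q1 (1 - x) 1"
    by (simp add: SW_full_one mirror add_divide_distrib)
qed

text \<open>No type need be indifferent, so \<open>g (1/2)\<close> is not determined. Type 2's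
  preference for H bounds it from below and type 1's IR on L from above; the constraint at
  \<open>x = 1/2\<close> says that these bounds are compatible.\<close>

lemma case_separated_bound:
  assumes adm: "admissible \<theta> c Q1 a g s" and sep: "case_separated s"
  shows "\<exists>x a'. IR21_feasible \<theta> c Q1 x a' \<and> social_welfare \<theta> c Q1 a g s \<le> SW_full \<theta> c Q1 x a'"
proof (intro exI conjI)
  define q where "q = Qtot Q1 (1/2) 1"
  have s: "s Type1 PathH = 0" "s Type1 PathL = 1/2" "s Type2 PathH = 1/2" "s Type2 PathL = 0"
    using sep by (auto simp: case_separated_def)
  have b: "participation s = 1" and x: "flow_H s = 1/2"
    by (simp_all add: participation_eq flow_H_def s)
  have a: "a \<in> {0..1}"
    using adm by (simp add: admissible_def)
  have "profile_payoff \<theta> c Q1 a g s Type2 PathL \<le> profile_payoff \<theta> c Q1 a g s Type2 PathH"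
    using adm s(3) by (simp add: admissible_def stable_equilibrium_def equilibrium_def)
  then have "a * \<theta> Type2 * q - g (1/2) \<le> \<theta> Type2 * q - c + g (1/2)"
    by (simp add: profile_payoff_def b x q_def)
  moreover have "0 \<le> profile_payoff \<theta> c Q1 a g s Type1 PathL"
    using adm s(2) by (simp add: admissible_def individually_rational_def)
  then have "g (1/2) \<le> a * \<theta> Type1 * q"
    by (simp add: profile_payoff_def b x q_def)
  ultimately show "IR21_feasible \<theta> c Q1 (1/2) a"
    using a by (simp add: IR21_feasible_def flip: q_def) (simp add: algebra_simps)
  show "social_welfare \<theta> c Q1 a g s \<le> SW_full \<theta> c Q1 (1/2) a"
    using social_welfare_eq[of s \<theta> c Q1 a g]
    by (simp add: x s b SW_full_def algebra_simps)
qed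

lemma case_IR2_bound:
  assumes adm: "admissible \<theta> c Q1 a g s" and IR2: "case_IR2 s"
  shows "\<exists>x\<in>{0..1/2}. social_welfare \<theta> c Q1 a g s \<le> SW_half \<theta> c Q1 x"
proof
  define x q where "x = flow_H s" and "q = Qtot Q1 x (1/2)"
  have s: "s Type1 PathH = 0" "s Type1 PathL = 0" "s Type2 PathH = x" "s Type2 PathL = 1/2 - x"
    using IR2 by (auto simp: case_IR2_def x_def flow_H_def)
  have b: "participation s = 1/2"
    by (simp add: participation_eq s)
  have x: "0 < x" "x < 1/2" and a: "a \<le> 1"
    using adm by (auto simp: admissible_def x_def b)
  then show "x \<in> {0..1/2}" by simp
  have q: "0 \<le> q"
    unfolding q_def using x by (intro Qtot_nonneg) auto
  have "social_welfare \<theta> c Q1 a g s = \<theta> Type2 * (x + a * (1/2 - x)) * q - x * c"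
    using social_welfare_eq[of s \<theta> c Q1 a g, folded x_def] x by (simp add: s b q_def)
  also have "\<dots> \<le> \<theta> Type2 * (1/2) * q - x * c"
  proof (intro diff_right_mono mult_right_mono mult_left_mono)
    have "a * (1/2 - x) \<le> 1 * (1/2 - x)"
      using x a by (intro mult_right_mono) auto
    then show "x + a * (1/2 - x) \<le> 1/2" by (simp add: algebra_simps)
  qed (use valuations q in auto)
  finally show "social_welfare \<theta> c Q1 a g s \<le> SW_half \<theta> c Q1 x"
    by (simp add: SW_half_def q_def)
qed

text \<open>Reduces a maximisation over all payment functions and states to two problems in real
  variables.\<close>

lemma admissible_bound:
  assumes "admissible \<theta> c Q1 a g s"
    and "\<And>x a'. IR21_feasible \<theta> c Q1 x a' \<Longrightarrow> SW_full \<theta> c Q1 x a' \<le> W"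
    and "\<And>x. x \<in> {0..1/2} \<Longrightarrow> SW_half \<theta> c Q1 x \<le> W"
  shows "social_welfare \<theta> c Q1 a g s \<le> W"
proof -
  consider "case_IR21 \<theta> c Q1 a g s" | "case_IR12 \<theta> c Q1 a g s" | "case_separated s" | "case_IR2 s"
    using assms(1) by (auto simp: admissible_def)
  then show ?thesis
    using case_IR21_bound[OF assms(1)] case_IR12_bound[OF assms(1)]
      case_separated_bound[OF assms(1)] case_IR2_bound[OF assms(1)] assms(2,3)
    by cases (meson order_trans)+
qed

section \<open>Optimality criterion and the full-participation mechanism\<close>

lemma optimalI:
  assumes "admissible \<theta> c Q1 a g s"
    and "\<And>x a'. IR21_feasible \<theta> c Q1 x a' \<Longrightarrow> SW_full \<theta> c Q1 x a' \<le> social_welfare \<theta> c Q1 a g s"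
    and "\<And>x. x \<in> {0..1/2} \<Longrightarrow> SW_half \<theta> c Q1 x \<le> social_welfare \<theta> c Q1 a g s"
  shows "optimal \<theta> c Q1 a g s"
  using assms(1) admissible_bound[OF _ assms(2,3)]
  by (auto simp: optimal_def is_arg_max_linorder)

text \<open>The payment at \<open>x\<close> makes type 2 indifferent; type 1 values the withheld
  content less and so weakly prefers L. Away from \<open>x\<close> the jump to \<open>M\<close> or
  \<open>-M\<close> outweighs all other incentives: below \<open>x\<close> it must exceed the travel
  cost, and above \<open>x\<close> the value of the withheld content, which is at most
  \<open>\<theta> Type2 * (2 * Q1 1)\<close>.\<close>

lemma full_profile_admissible:
  fixes x a M :: real
  defines "g \<equiv> full_payment \<theta> c Q1 a x M" and "s \<equiv> split_profile (1/2) x"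
  assumes feas: "IR21_feasible \<theta> c Q1 x a" and M: "c < M" "\<theta> Type2 * (2 * Q1 1) < M"
  shows "case_IR21 \<theta> c Q1 a g s" "admissible \<theta> c Q1 a g s"
    "social_welfare \<theta> c Q1 a g s = SW_full \<theta> c Q1 x a"
proof -
  define q where "q = Qtot Q1 x 1"
  have x: "0 < x" "x \<le> 1/2" and a: "0 \<le> a" "a \<le> 1"
    and slack: "0 \<le> \<theta> Type1 * a * q - (c - (1 - a) * \<theta> Type2 * q) * x"
    using feas by (auto simp: IR21_feasible_def q_def)
  have q: "0 \<le> q"
    unfolding q_def using x by (intro Qtot_nonneg) auto
  have M_pos: "0 < M" using M c_pos by simp
  have gx: "g x = (c - (1 - a) * \<theta> Type2 * q) * x"
    by (simp add: g_def full_payment_def q_def)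
  have s_simps: "s Type1 PathH = 0" "s Type1 PathL = 1/2" "s Type2 PathH = x"
      "s Type2 PathL = 1/2 - x" "flow_H s = x" "participation s = 1"
    by (simp_all add: s_def)
  have payoff_s: "profile_payoff \<theta> c Q1 a g s i p = payoff \<theta> c Q1 a g 1 i p x" for i p
    by (simp add: profile_payoff_def s_simps)
  have diff: "payoff \<theta> c Q1 a g 1 i PathH x - payoff \<theta> c Q1 a g 1 i PathL x
      = (1 - a) * (\<theta> i - \<theta> Type2) * q" for i
    using x by (simp add: payoff_H_minus_L gx flip: q_def) (simp add: algebra_simps)
  have indiff2: "payoff \<theta> c Q1 a g 1 Type2 PathH x = payoff \<theta> c Q1 a g 1 Type2 PathL x"
    using diff[of Type2] by simp
  have pref1: "payoff \<theta> c Q1 a g 1 Type1 PathH x \<le> payoff \<theta> c Q1 a g 1 Type1 PathL x"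
  proof -
    have "(1 - a) * (\<theta> Type1 - \<theta> Type2) * q \<le> 0"
      using a q valuations by (intro mult_nonpos_nonneg mult_nonneg_nonpos) auto
    then show ?thesis using diff[of Type1] by simp
  qed
  have IR1: "0 \<le> payoff \<theta> c Q1 a g 1 Type1 PathL x"
    using slack by (simp add: gx mult_ac flip: q_def)
  have IR2: "0 \<le> payoff \<theta> c Q1 a g 1 Type2 PathL x"
  proof -
    have "a * \<theta> Type1 * q \<le> a * \<theta> Type2 * q"
      using a q valuations by (intro mult_right_mono mult_left_mono) auto
    then show ?thesis using IR1 by (simp flip: q_def)
  qed
  show case21: "case_IR21 \<theta> c Q1 a g s"
    using indiff2 by (simp add: case_IR21_def indifferent_def payoff_s) (simp add: s_simps)
  have "equilibrium \<theta> c Q1 a g s"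
    using indiff2 pref1 by (auto simp: equilibrium_def all_user_type_iff all_path_iff payoff_s s_simps
        simp del: payoff.simps)
  moreover have "payoff \<theta> c Q1 a g 1 i PathL y < payoff \<theta> c Q1 a g 1 i PathH y"
    if y: "0 < y" "y < x" for i y
  proof -
    \<comment> \<open>As \<open>b = 1\<close>, the payment enters the comparison as
      \<open>M / y\<close>, and \<open>y < 1\<close> only enlarges it.\<close>
    have "M \<le> M / y"
      using y x M_pos by (simp add: field_simps)
    moreover have "0 \<le> (1 - a) * \<theta> i * Qtot Q1 y 1"
      using a valuations Qtot_nonneg[of y 1] y x by (cases i) auto
    ultimately have "c < (1 - a) * \<theta> i * Qtot Q1 y 1 + 1 * M / y"
      using M by simp
    then show ?thesis
      using y by (subst payoff_L_less_H_iff) (auto simp: g_def full_payment_def)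
  qed
  moreover have "payoff \<theta> c Q1 a g 1 i PathH y < payoff \<theta> c Q1 a g 1 i PathL y"
    if y: "x < y" "y < 1" for i y
  proof -
    have "M \<le> M / y"
      using y x M_pos by (simp add: field_simps)
    moreover have "(1 - a) * \<theta> i * Qtot Q1 y 1 \<le> 1 * \<theta> Type2 * (2 * Q1 1)"
      using a valuations Qtot_le[of y 1] Qtot_nonneg[of y 1] y x
      by (intro mult_mono) (cases i; auto)+
    ultimately have "(1 - a) * \<theta> i * Qtot Q1 y 1 + 1 * (- M) / y < c"
      using M c_pos by simp
    then show ?thesis
      using y x by (subst payoff_H_less_L_iff) (auto simp: g_def full_payment_def)
  qed
  \<comment> \<open>The strict preferences hold at every flow strictly between 0 and 1 other than
    \<open>x\<close>, so any radius will do.\<close>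
  ultimately have "stable_equilibrium \<theta> c Q1 a g s"
    unfolding stable_equilibrium_def Let_def
    by (intro conjI exI[of _ 1]) (auto simp: s_simps simp del: payoff.simps)
  moreover have "individually_rational \<theta> c Q1 a g s"
    using IR1 IR2 indiff2 by (auto simp: individually_rational_def all_user_type_iff all_path_iff
        payoff_s s_simps simp del: payoff.simps)
  moreover have "valid_profile s"
    using x by (simp add: valid_profile_def all_user_type_iff all_path_iff s_simps)
  ultimately show "admissible \<theta> c Q1 a g s"
    using x a case21 by (simp add: admissible_def) (simp add: s_simps)
  show "social_welfare \<theta> c Q1 a g s = SW_full \<theta> c Q1 x a"
    using x social_welfare_eq[of s \<theta> c Q1 a g]
    by (simp add: s_simps SW_full_def) (simp add: algebra_simps)
qed

section \<open>The half-participation mechanism\<close>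

lemma half_payment_at: "x < 1/2 \<Longrightarrow> half_payment c x (1/2) x = 2 * x * c"
  by (simp add: half_payment_def)

text \<open>With \<open>a = 1\<close> the difference between the paths is the same for both types.
  At flow \<open>x\<close> either path costs a user \<open>2 * x * c\<close> net, the average travel
  cost of the participants. Type 2's payoff is therefore twice \<open>SW_half\<close>, and
  \<open>out1\<close> says that type 1 would lose by joining.\<close>

lemma half_profile_admissible:
  fixes x :: real
  defines "g \<equiv> half_payment c x (1/2)" and "s \<equiv> split_profile 0 x"
  assumes x: "0 < x" "x < 1/2"
    and IR2: "0 \<le> SW_half \<theta> c Q1 x" and out1: "\<theta> Type1 * Qtot Q1 x (1/2) < 2 * x * c"
  shows "case_IR2 s" "admissible \<theta> c Q1 1 g s" "social_welfare \<theta> c Q1 1 g s = SW_half \<theta> c Q1 x"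
proof -
  have gx: "g x = 2 * x * c"
    using x half_payment_at by (simp add: g_def)
  have s_simps: "s Type1 PathH = 0" "s Type1 PathL = 0" "s Type2 PathH = x"
      "s Type2 PathL = 1/2 - x" "flow_H s = x" "participation s = 1/2"
    by (simp_all add: s_def)
  have payoff_s: "profile_payoff \<theta> c Q1 1 g s i p = \<theta> i * Qtot Q1 x (1/2) - 2 * x * c" for i p
    using x by (cases p) (simp_all add: profile_payoff_def s_simps gx field_simps)
  \<comment> \<open>The gain from being on H, net of its cost, is a positive multiple of
    \<open>x - y\<close>: it changes sign exactly at the target flow, which gives stability.\<close>
  have ratio: "(1/2) * g y / y < c \<longleftrightarrow> x < y" "c < (1/2) * g y / y \<longleftrightarrow> y < x"
    if "0 < y" for y
  proof -
    have "(1/2) * g y / y - c = c * ((1/2) * (x - y)) / (y * (1/2 - x))"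
      using that x unfolding g_def half_payment_def by (simp add: divide_simps) (simp add: algebra_simps)
    moreover have "0 < y * (1/2 - x)"
      using that x by simp
    ultimately show "(1/2) * g y / y < c \<longleftrightarrow> x < y" "c < (1/2) * g y / y \<longleftrightarrow> y < x"
      using c_pos by (smt (verit) zero_less_divide_iff divide_less_0_iff zero_less_mult_iff mult_less_0_iff)+
  qed
  show case2: "case_IR2 s"
    by (simp add: case_IR2_def s_simps)
  have "equilibrium \<theta> c Q1 1 g s"
    by (simp add: equilibrium_def payoff_s)
  moreover have "payoff \<theta> c Q1 1 g (1/2) i PathL y < payoff \<theta> c Q1 1 g (1/2) i PathH y"
    if "0 < y" "y < x" for i y
    using that ratio(2)[of y] by (subst payoff_L_less_H_iff) auto
  moreover have "payoff \<theta> c Q1 1 g (1/2) i PathH y < payoff \<theta> c Q1 1 g (1/2) i PathL y"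
    if "x < y" for i y
    using that x ratio(1)[of y] by (subst payoff_H_less_L_iff) auto
  ultimately have "stable_equilibrium \<theta> c Q1 1 g s"
    unfolding stable_equilibrium_def Let_def
    by (intro conjI exI[of _ 1]) (auto simp: s_simps simp del: payoff.simps)
  moreover have "individually_rational \<theta> c Q1 1 g s"
    using IR2 out1 x
    by (auto simp: individually_rational_def payoff_s all_user_type_iff all_path_iff SW_half_def)
      (simp_all add: s_simps)
  moreover have "valid_profile s"
    using x by (simp add: valid_profile_def all_user_type_iff all_path_iff s_simps)
  ultimately show "admissible \<theta> c Q1 1 g s"
    using x case2 by (simp add: admissible_def) (simp add: s_simps)
  show "social_welfare \<theta> c Q1 1 g s = SW_half \<theta> c Q1 x"
    using x social_welfare_eq[of s \<theta> c Q1 1 g]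
    by (simp add: s_simps SW_half_def)
qed

section \<open>Comparison of half with full participation\<close>

lemma SW_half_zero_le_SW_full:
  "\<exists>x. IR21_feasible \<theta> c Q1 x 1 \<and> SW_half \<theta> c Q1 0 \<le> SW_full \<theta> c Q1 x 1"
proof (intro exI conjI)
  \<comment> \<open>The flow is small enough that the travel cost is covered by what the type 1
    users contribute to welfare. Their mass is \<open>1/2\<close>, hence the 2 in the denominator.
    The remaining type 2 part is at least \<open>SW_half\<close> at 0.\<close>
  define x where "x = min (1/2) (\<theta> Type1 * Q1 1 / (2 * c))"
  have pos: "0 < \<theta> Type1 * Q1 1"
    using valuations Q1_one_pos by simp
  then have x: "0 < x" "x \<le> 1/2"
    using c_pos by (auto simp: x_def)
  have "x \<le> \<theta> Type1 * Q1 1 / (2 * c)"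
    by (simp add: x_def)
  then have cost: "2 * (x * c) \<le> \<theta> Type1 * Q1 1"
    using c_pos by (simp add: field_simps)
  have q: "Q1 1 \<le> Qtot Q1 x 1"
    using x by (intro Q1_one_le_Qtot) auto
  have t1: "\<theta> Type1 * Q1 1 \<le> \<theta> Type1 * Qtot Q1 x 1"
    using valuations q by (intro mult_left_mono) auto
  show "IR21_feasible \<theta> c Q1 x 1"
    using x cost t1 pos by (simp add: IR21_feasible_one)
  have "\<theta> Type2 * Q1 (1/2) \<le> \<theta> Type2 * Qtot Q1 x 1"
    using valuations q Q1_le[of "1/2" 1] by (intro mult_left_mono) auto
  then show "SW_half \<theta> c Q1 0 \<le> SW_full \<theta> c Q1 x 1"
    using cost t1 by (simp add: SW_full_one SW_half_def Qtot_def[of _ 0] Q1_zero algebra_simps)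
qed

text \<open>If type 1 would not lose at the half-participation payment, admit it at the same flow
  with \<open>a = 1\<close>: the content does not shrink, the travel cost is unchanged and type 1
  adds a nonnegative term. Used contrapositively to show that type 1 stays out.\<close>

lemma SW_half_le_SW_full:
  assumes x: "0 < x" "x \<le> 1/2" and "2 * x * c \<le> \<theta> Type1 * Qtot Q1 x (1/2)"
  shows "IR21_feasible \<theta> c Q1 x 1" "SW_half \<theta> c Q1 x \<le> SW_full \<theta> c Q1 x 1"
proof -
  have q: "Qtot Q1 x (1/2) \<le> Qtot Q1 x 1" and q0: "0 \<le> Qtot Q1 x 1"
    using x by (auto intro: Qtot_half_le Qtot_nonneg)
  have "\<theta> Type1 * Qtot Q1 x (1/2) \<le> \<theta> Type1 * Qtot Q1 x 1"
    using valuations q by (intro mult_left_mono) auto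
  moreover have "0 < x * c" using x c_pos by simp
  ultimately show "IR21_feasible \<theta> c Q1 x 1"
    using assms by (simp add: IR21_feasible_one)
  have "\<theta> Type2 * Qtot Q1 x (1/2) \<le> \<theta> Type2 * Qtot Q1 x 1"
    using valuations q by (intro mult_left_mono) auto
  moreover have "0 \<le> \<theta> Type1 * Qtot Q1 x 1"
    using valuations q0 by simp
  ultimately show "SW_half \<theta> c Q1 x \<le> SW_full \<theta> c Q1 x 1"
    by (simp add: SW_full_one SW_half_def algebra_simps)
qed

text \<open>Flows 0 and \<open>1/2\<close> give the same content by symmetry, but the latter costs
  \<open>c / 2\<close>. This keeps L in use and the denominator of \<open>half_payment\<close>
  nonzero.\<close>

lemma SW_half_arg_max_less_half:
  assumes "is_arg_max (SW_half \<theta> c Q1) (\<lambda>x. x \<in> {0..1/2}) x"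
  shows "x < 1/2"
proof (rule ccontr)
  assume "\<not> x < 1/2"
  then have x: "x = 1/2"
    using assms by (auto simp: is_arg_max_def)
  have "SW_half \<theta> c Q1 0 \<le> SW_half \<theta> c Q1 x"
    using assms by (auto simp: is_arg_max_linorder)
  then show False
    using c_pos by (simp add: x SW_half_def Qtot_def add.commute)
qed

end

section \<open>The two regimes\<close>

theorem theorem4:
  fixes \<theta> :: "user_type \<Rightarrow> real" and c :: real and Q1 :: "real \<Rightarrow> real"
    and xc ac xt :: real
  assumes c_pos: "0 < c"
    and valuations: "0 < \<theta> Type1" "\<theta> Type1 < \<theta> Type2"
    and Q1_range: "Q1 \<in> {0..1} \<rightarrow> {0..}"
    and Q1_cont: "continuous_on {0..1} Q1"
    and Q1_concave: "concave_on {0..1} Q1"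
    and Q1_mono: "mono_on {0..1} Q1"
    and Q1_zero: "Q1 0 = 0"
    and Q_strict: "strict_mono_on {0..1/2} (\<lambda>x. Qtot Q1 x 1)"
    and check_opt: "is_arg_max (\<lambda>(x, a). SW_full \<theta> c Q1 x a)
                      (\<lambda>(x, a). IR21_feasible \<theta> c Q1 x a) (xc, ac)"
    and tilde_opt: "is_arg_max (SW_half \<theta> c Q1) (\<lambda>x. x \<in> {0..1/2}) xt"
  shows "(SW_full \<theta> c Q1 xc ac \<ge> SW_half \<theta> c Q1 xt \<longrightarrow>
           (\<forall>\<^sub>F M in at_top. \<exists>s.
              case_IR21 \<theta> c Q1 ac (full_payment \<theta> c Q1 ac xc M) s \<and>
              flow_H s = xc \<and>
              optimal \<theta> c Q1 ac (full_payment \<theta> c Q1 ac xc M) s \<and>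
              social_welfare \<theta> c Q1 ac (full_payment \<theta> c Q1 ac xc M) s = SW_full \<theta> c Q1 xc ac)) \<and>
         (SW_full \<theta> c Q1 xc ac < SW_half \<theta> c Q1 xt \<longrightarrow>
           (\<exists>s. case_IR2 s \<and>
              flow_H s = xt \<and>
              optimal \<theta> c Q1 1 (half_payment c xt (1/2)) s \<and>
              social_welfare \<theta> c Q1 1 (half_payment c xt (1/2)) s = SW_half \<theta> c Q1 xt))"
proof -
  interpret content_market \<theta> c Q1
    using c_pos valuations Q1_range Q1_mono Q1_zero Q_strict by unfold_locales
  have feas: "IR21_feasible \<theta> c Q1 xc ac"
    and full_le: "\<And>x a. IR21_feasible \<theta> c Q1 x a \<Longrightarrow> SW_full \<theta> c Q1 x a \<le> SW_full \<theta> c Q1 xc ac"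
    using check_opt by (auto simp: is_arg_max_linorder)
  have xt: "0 \<le> xt" "xt < 1/2"
    and half_le: "\<And>x. x \<in> {0..1/2} \<Longrightarrow> SW_half \<theta> c Q1 x \<le> SW_half \<theta> c Q1 xt"
    using tilde_opt SW_half_arg_max_less_half by (auto simp: is_arg_max_linorder)
  show ?thesis
  proof (intro conjI impI)
    assume ge: "SW_half \<theta> c Q1 xt \<le> SW_full \<theta> c Q1 xc ac"
    \<comment> \<open>These two thresholds make \<open>M\<close> large enough to act as an infinite
      payment.\<close>
    have "\<forall>\<^sub>F M in at_top. c < M \<and> \<theta> Type2 * (2 * Q1 1) < M"
      by (intro eventually_conj eventually_gt_at_top)
    then show "\<forall>\<^sub>F M in at_top. \<exists>s.
        case_IR21 \<theta> c Q1 ac (full_payment \<theta> c Q1 ac xc M) s \<and> flow_H s = xc \<and>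
        optimal \<theta> c Q1 ac (full_payment \<theta> c Q1 ac xc M) s \<and>
        social_welfare \<theta> c Q1 ac (full_payment \<theta> c Q1 ac xc M) s = SW_full \<theta> c Q1 xc ac"
    proof eventually_elim
      case (elim M)
      note s = full_profile_admissible[OF feas elim[THEN conjunct1] elim[THEN conjunct2]]
      have "optimal \<theta> c Q1 ac (full_payment \<theta> c Q1 ac xc M) (split_profile (1/2) xc)"
        using full_le order_trans[OF half_le ge] by (intro optimalI s(2)) (simp_all add: s(3))
      then show ?case
        using s(1,3) by (intro exI[of _ "split_profile (1/2) xc"]) simp
    qed
  next
    assume less: "SW_full \<theta> c Q1 xc ac < SW_half \<theta> c Q1 xt"
    have "xt \<noteq> 0"
      using SW_half_zero_le_SW_full full_le less by force
    with xt have xt_pos: "0 < xt" by simp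
    have out1: "\<theta> Type1 * Qtot Q1 xt (1/2) < 2 * xt * c"
      using SW_half_le_SW_full[of xt] xt_pos xt full_le[of xt 1] less by force
    \<comment> \<open>The zero flow already has nonnegative welfare, hence so does the maximiser;
      this is type 2's individual rationality.\<close>
    have "0 \<le> SW_half \<theta> c Q1 0"
      using valuations Q1_nonneg[of "1/2"] by (simp add: SW_half_def Qtot_def Q1_zero)
    also have "\<dots> \<le> SW_half \<theta> c Q1 xt"
      by (rule half_le) simp
    finally have "0 \<le> SW_half \<theta> c Q1 xt" .
    note s = half_profile_admissible[OF xt_pos xt(2) this out1]
    have "optimal \<theta> c Q1 1 (half_payment c xt (1/2)) (split_profile 0 xt)"
      using half_le full_le less by (intro optimalI s(2)) (force simp: s(3))+
    then show "\<exists>s. case_IR2 s \<and> flow_H s = xt \<and>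
        optimal \<theta> c Q1 1 (half_payment c xt (1/2)) s \<and>
        social_welfare \<theta> c Q1 1 (half_payment c xt (1/2)) s = SW_half \<theta> c Q1 xt"
      using s(1,3) by (intro exI[of _ "split_profile 0 xt"]) simp
  qed
qed

end
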